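(* Let $\gamma>1$, $\phi=\frac{2}{1+\gamma}$ and $c_0>0$. There exists $R_0>3$ such that for every $R\ge R_0$ the following holds. Let $\lambda\ge c_0$, let the sign $\pm$ be either $+$ or $-$, and let $W_{\lambda,\pm R}:[0,3]\to[0,\infty)$ be a solution, positive on $(0,3]$, of the ODE problem $$W_{\lambda,\pm R}''(t)+\frac{1}{t\pm R}W_{\lambda,\pm R}'(t)=-\left(W_{\lambda,\pm R}(t)\right)^{-\gamma}\ \text{ for }t\in(0,3),\qquad W_{\lambda,\pm R}(3)=\lambda,\qquad W_{\lambda,\pm R}(0)=0.$$ Then $$W_{\lambda,\pm R}(t)\sim\begin{cases}t^{\phi},&\text{if }t\le\lambda^{\frac{1+\gamma}{1-\gamma}},\\ \lambda t,&\text{if }\lambda^{\frac{1+\gamma}{1-\gamma}}\le t\le1,\\ \lambda,&\text{if }1\le t\le3.\end{cases}$$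
   Context: $t$ ranges over $[0,3]$. $q_1\sim q_2$ means $C^{-1}q_2\le q_1\le Cq_2$ with a constant $C>0$ depending only on $(\gamma,c_0,R)$, not on $\lambda$ or $t$. The solution is $C^2$ on $(0,3)$ and continuous on $[0,3]$. *)

theory Defs
  imports Complex_Main
begin

text \<open>The parameter \<open>s\<close> stands for the signed quantity \<open>\<plusminus>R\<close>. The functions \<open>W1\<close> and \<open>W2\<close>
  are the first and second derivatives of \<open>W\<close> on the open interval. Values of \<open>W\<close> outside
  \<open>[0,3]\<close> are irrelevant.\<close>

definition ode_solution :: "real \<Rightarrow> real \<Rightarrow> real \<Rightarrow> (real \<Rightarrow> real) \<Rightarrow> bool" where
  "ode_solution \<gamma> s lam W \<longleftrightarrow>
     continuous_on {0..3} W \<and>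
     (\<forall>t\<in>{0..3}. 0 \<le> W t) \<and>
     (\<forall>t\<in>{0<..3}. 0 < W t) \<and>
     (\<exists>W1 W2. (\<forall>t\<in>{0<..<3}.
           (W has_real_derivative W1 t) (at t) \<and>
           (W1 has_real_derivative W2 t) (at t) \<and>
           W2 t + 1 / (t + s) * W1 t = - (W t powr (- \<gamma>))) \<and>
        continuous_on {0<..<3} W2) \<and>
     W 3 = lam \<and> W 0 = 0"

definition comparable :: "real \<Rightarrow> real \<Rightarrow> real \<Rightarrow> bool" where
  "comparable C q1 q2 \<longleftrightarrow> inverse C * q2 \<le> q1 \<and> q1 \<le> C * q2"

end

theory Submission
  imports Defs
begin

text \<open>The operator \<open>L u = u'' + u' / (t + s)\<close> equals \<open>(p u')' / p\<close> with \<open>p = \<bar>t + s\<bar>\<close>, so it obeys a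
  maximum principle, and everything follows by comparing \<open>W\<close> with explicit barriers. A multiple of
  \<open>lam (t\<^sup>2 + t)\<close> lies below \<open>W\<close>. If \<open>M\<close> is the maximum of \<open>W\<close> on \<open>[0, t]\<close>, then \<open>L W \<le> - M\<^bsup>-\<gamma>\<^esup>\<close> there,
  and a parabola as barrier gives \<open>M \<ge> c t\<^bsup>\<phi>\<^esup>\<close>; since constants are barriers, \<open>W t \<ge> min M lam\<close>, whence
  \<open>W \<ge> c t\<^bsup>\<phi>\<^esup>\<close>. This bounds the right hand side of the equation by a multiple of \<open>t\<^bsup>\<phi> - 2\<^esup>\<close>, so that
  \<open>A t\<^bsup>\<phi>\<^esup> + lam t (4 - t) / 3\<close> is an upper barrier. Thus \<open>W\<close> is comparable to \<open>max (t\<^bsup>\<phi>\<^esup>) (lam t)\<close>.\<close>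

section \<open>Maximum principle\<close>

text \<open>A positive interior value forces, by the mean value theorem on both sides, points
  \<open>x < t < y\<close> with \<open>u1 x > 0 > u1 y\<close>. This contradicts the monotonicity of
  \<open>\<sigma> * (t + s) * u1 t\<close>, whose derivative is a positive weight times
  \<open>L u\<close>. The sign \<open>\<sigma>\<close> makes the weight positive for either sign of
  \<open>s\<close>.\<close>

lemma radial_maximum_principle:
  fixes u u1 u2 :: "real \<Rightarrow> real"
  assumes cont: "continuous_on {a..b} u"
    and sgn: "\<And>t. a < t \<Longrightarrow> t < b \<Longrightarrow> 0 < \<sigma> * (t + s)"
    and d1: "\<And>t. a < t \<Longrightarrow> t < b \<Longrightarrow> (u has_real_derivative u1 t) (at t)"
    and d2: "\<And>t. a < t \<Longrightarrow> t < b \<Longrightarrow> (u1 has_real_derivative u2 t) (at t)"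
    and L: "\<And>t. a < t \<Longrightarrow> t < b \<Longrightarrow> 0 \<le> u2 t + 1 / (t + s) * u1 t"
    and ends: "u a \<le> 0" "u b \<le> 0" and t: "a \<le> t" "t \<le> b"
  shows "u t \<le> 0"
proof (rule ccontr)
  assume "\<not> u t \<le> 0"
  then have pos: "u t > 0" by simp
  then have "a < t" "t < b" using ends t by (auto simp: order.order_iff_strict)
  obtain l x where x: "a < x" "x < t" "(u has_real_derivative l) (at x)" "u t - u a = (t - a) * l"
  proof -
    have "continuous_on {a..t} u" using \<open>t < b\<close> by (intro continuous_on_subset[OF cont]) auto
    moreover have "u differentiable (at x)" if "a < x" "x < t" for x
      using d1[of x] that \<open>t < b\<close> real_differentiable_def by auto
    ultimately show ?thesis using MVT[OF \<open>a < t\<close>] that by blast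
  qed
  obtain l' y where y: "t < y" "y < b" "(u has_real_derivative l') (at y)" "u b - u t = (b - t) * l'"
  proof -
    have "continuous_on {t..b} u" using \<open>a < t\<close> by (intro continuous_on_subset[OF cont]) auto
    moreover have "u differentiable (at x)" if "t < x" "x < b" for x
      using d1[of x] that \<open>a < t\<close> real_differentiable_def by auto
    ultimately show ?thesis using MVT[OF \<open>t < b\<close>] that by blast
  qed
  have l: "l = u1 x" "l' = u1 y"
    using x y d1[of x] d1[of y] \<open>a < t\<close> \<open>t < b\<close> by (auto intro: DERIV_unique)
  have "0 < (t - a) * u1 x" using x(4) pos ends unfolding l by linarith
  then have ux: "0 < u1 x" using \<open>a < t\<close> by (simp add: zero_less_mult_iff)
  have "(b - t) * u1 y < 0" using y(4) pos ends unfolding l by linarith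
  then have uy: "u1 y < 0" using \<open>t < b\<close> by (simp add: mult_less_0_iff)
  \<comment> \<open>The factor \<open>\<sigma> * (t + s)\<close> is an integrating factor: it turns
    \<open>L u\<close> into the derivative of a single product.\<close>
  have "\<sigma> * (x + s) * u1 x \<le> \<sigma> * (y + s) * u1 y"
  proof (rule DERIV_nonneg_imp_nondecreasing[where f = "\<lambda>t. \<sigma> * (t + s) * u1 t"])
    show "x \<le> y" using x y by simp
    fix z assume "x \<le> z" "z \<le> y"
    then have z: "a < z" "z < b" using x y by auto
    have "((\<lambda>t. \<sigma> * (t + s) * u1 t) has_real_derivative \<sigma> * u1 z + \<sigma> * (z + s) * u2 z) (at z)"
      by (auto intro!: derivative_eq_intros d2 z)
    moreover have "\<sigma> * u1 z + \<sigma> * (z + s) * u2 z = \<sigma> * (z + s) * (u2 z + 1 / (z + s) * u1 z)"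
    proof -
      have "z + s \<noteq> 0" using sgn[OF z] by force
      then have "(z + s) * (1 / (z + s)) = 1" by simp
      then show ?thesis by algebra
    qed
    moreover have "\<dots> \<ge> 0"
      using sgn[OF z] L[OF z] by simp
    ultimately show "\<exists>d. ((\<lambda>t. \<sigma> * (t + s) * u1 t) has_real_derivative d) (at z) \<and> 0 \<le> d"
      by auto
  qed
  moreover have "0 < \<sigma> * (x + s)" "0 < \<sigma> * (y + s)"
    using sgn x y by auto
  ultimately show False
    using ux uy mult_pos_pos mult_pos_neg by (smt (verit))
qed

section \<open>Comparison with barriers\<close>

text \<open>Largeness of \<open>R\<close> enters through \<open>far\<close> and
  \<open>far_phi\<close>: the first lets second derivatives of quadratic barriers absorb the drift
  term, the second does so for \<open>t powr \<phi>\<close>, at the cost of half the factor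
  \<open>1 - \<phi>\<close>.\<close>

locale radial_ode =
  fixes \<gamma> \<phi> s \<sigma> lam :: real and W W1 W2 :: "real \<Rightarrow> real"
  assumes gamma: "\<gamma> > 1" and phi: "\<phi> = 2 / (1 + \<gamma>)"
    and sgn: "\<And>t. 0 < t \<Longrightarrow> t < 3 \<Longrightarrow> 0 < \<sigma> * (t + s)"
    and far: "\<And>t. 0 < t \<Longrightarrow> t < 3 \<Longrightarrow> \<bar>1 / (t + s)\<bar> \<le> 1 / 4"
    and far_phi: "\<And>t. 0 < t \<Longrightarrow> t < 3 \<Longrightarrow> t * \<bar>1 / (t + s)\<bar> \<le> (1 - \<phi>) / 2"
    and cont: "continuous_on {0..3} W"
    and pos: "\<And>t. 0 < t \<Longrightarrow> t \<le> 3 \<Longrightarrow> 0 < W t"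
    and W0: "W 0 = 0" and W3: "W 3 = lam"
    and W1: "\<And>t. 0 < t \<Longrightarrow> t < 3 \<Longrightarrow> (W has_real_derivative W1 t) (at t)"
    and W2: "\<And>t. 0 < t \<Longrightarrow> t < 3 \<Longrightarrow> (W1 has_real_derivative W2 t) (at t)"
    and ode: "\<And>t. 0 < t \<Longrightarrow> t < 3 \<Longrightarrow> W2 t + 1 / (t + s) * W1 t = - (W t powr - \<gamma>)"
begin

lemma phi_bounds: "0 < \<phi>" "\<phi> < 1"
  using gamma by (simp_all add: phi)

lemma lam_pos: "0 < lam"
  using pos[of 3] W3 by simp

text \<open>The nonlinear term is evaluated at \<open>W\<close> on both sides, so
  \<open>L (h - W) \<ge> 0\<close> and the linear maximum principle applies. The interval is kept
  general for later use on \<open>[0, T]\<close> and \<open>[a, 3]\<close>.\<close>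

lemma lower_barrier:
  assumes ab: "0 \<le> a" "b \<le> 3" and h: "continuous_on {a..b} h"
    and h1: "\<And>t. a < t \<Longrightarrow> t < b \<Longrightarrow> (h has_real_derivative h1 t) (at t)"
    and h2: "\<And>t. a < t \<Longrightarrow> t < b \<Longrightarrow> (h1 has_real_derivative h2 t) (at t)"
    and L: "\<And>t. a < t \<Longrightarrow> t < b \<Longrightarrow> - (W t powr - \<gamma>) \<le> h2 t + 1 / (t + s) * h1 t"
    and "h a \<le> W a" "h b \<le> W b" "a \<le> t" "t \<le> b"
  shows "h t \<le> W t"
proof -
  have "h t - W t \<le> 0"
  proof (rule radial_maximum_principle[where a = a and b = b and u = "\<lambda>t. h t - W t"])
    show "continuous_on {a..b} (\<lambda>t. h t - W t)"
      using ab by (intro continuous_intros h continuous_on_subset[OF cont]) auto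
    fix t assume t: "a < t" "t < b"
    then have t': "0 < t" "t < 3" using ab by auto
    show "0 < \<sigma> * (t + s)" using sgn t' by blast
    show "((\<lambda>t. h t - W t) has_real_derivative h1 t - W1 t) (at t)"
      by (intro DERIV_diff h1 W1 t t')
    show "((\<lambda>t. h1 t - W1 t) has_real_derivative h2 t - W2 t) (at t)"
      by (intro DERIV_diff h2 W2 t t')
    show "0 \<le> h2 t - W2 t + 1 / (t + s) * (h1 t - W1 t)"
      using L[OF t] ode[OF t'] by (simp add: right_diff_distrib diff_divide_distrib)
  qed (use assms in auto)
  then show ?thesis by simp
qed

lemma upper_barrier:
  assumes h: "continuous_on {0..3} h"
    and h1: "\<And>t. 0 < t \<Longrightarrow> t < 3 \<Longrightarrow> (h has_real_derivative h1 t) (at t)"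
    and h2: "\<And>t. 0 < t \<Longrightarrow> t < 3 \<Longrightarrow> (h1 has_real_derivative h2 t) (at t)"
    and L: "\<And>t. 0 < t \<Longrightarrow> t < 3 \<Longrightarrow> h2 t + 1 / (t + s) * h1 t \<le> - (W t powr - \<gamma>)"
    and "0 \<le> h 0" "lam \<le> h 3" "0 \<le> t" "t \<le> 3"
  shows "W t \<le> h t"
proof -
  have "W t - h t \<le> 0"
  proof (rule radial_maximum_principle[where a = 0 and b = 3 and u = "\<lambda>t. W t - h t"])
    show "continuous_on {0..3} (\<lambda>t. W t - h t)"
      by (intro continuous_intros h cont)
    fix t :: real assume t: "0 < t" "t < 3"
    show "0 < \<sigma> * (t + s)" using sgn t by blast
    show "((\<lambda>t. W t - h t) has_real_derivative W1 t - h1 t) (at t)"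
      by (intro DERIV_diff h1 W1 t)
    show "((\<lambda>t. W1 t - h1 t) has_real_derivative W2 t - h2 t) (at t)"
      by (intro DERIV_diff h2 W2 t)
    show "0 \<le> W2 t - h2 t + 1 / (t + s) * (W1 t - h1 t)"
      using L[OF t] ode[OF t] by (simp add: right_diff_distrib diff_divide_distrib)
  qed (use assms W0 W3 in auto)
  then show ?thesis by simp
qed

text \<open>Meant for \<open>x\<close> the slope of a quadratic barrier and \<open>k\<close> the
  size of its second derivative, up to a common factor; it rests on \<open>far\<close>.\<close>

lemma drift_bound:
  assumes "0 < t" "t < 3" "\<bar>x\<bar> \<le> 4 * k"
  shows "0 \<le> k + 1 / (t + s) * x" "- k + 1 / (t + s) * x \<le> 0"
proof -
  have "\<bar>1 / (t + s)\<bar> * \<bar>x\<bar> \<le> 1 / 4 * \<bar>x\<bar>"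
    by (intro mult_right_mono far assms) auto
  then have "\<bar>1 / (t + s) * x\<bar> \<le> k" using assms(3) unfolding abs_mult by linarith
  then show "0 \<le> k + 1 / (t + s) * x" "- k + 1 / (t + s) * x \<le> 0"
    unfolding abs_le_iff by auto
qed

section \<open>Lower bounds\<close>

lemma linear_lower_bound:
  assumes "0 \<le> t" "t \<le> 3"
  shows "lam * t / 12 \<le> W t"
proof -
  have "lam / 12 * (t\<^sup>2 + t) \<le> W t"
  \<comment> \<open>The square supplies convexity to beat the drift:
    \<open>2 * t + 1 \<le> 7\<close>, below the allowed \<open>4 * 2\<close>. Since 12 = 9 + 3, the
    barrier equals \<open>lam\<close> at 3.\<close>
  proof (rule lower_barrier[where a = 0 and b = 3 and h = "\<lambda>t. lam / 12 * (t\<^sup>2 + t)"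
        and ?h1.0 = "\<lambda>t. lam / 12 * (2 * t + 1)" and ?h2.0 = "\<lambda>t. lam / 12 * 2"])
    fix t :: real assume t: "0 < t" "t < 3"
    show "((\<lambda>t. lam / 12 * (t\<^sup>2 + t)) has_real_derivative lam / 12 * (2 * t + 1)) (at t)"
      by (auto intro!: derivative_eq_intros)
    show "((\<lambda>t. lam / 12 * (2 * t + 1)) has_real_derivative lam / 12 * 2) (at t)"
      by (auto intro!: derivative_eq_intros)
    have "0 \<le> 2 + 1 / (t + s) * (2 * t + 1)"
      using t by (intro drift_bound(1)) auto
    then have "0 \<le> lam / 12 * (2 + 1 / (t + s) * (2 * t + 1))"
      using lam_pos by simp
    also have "\<dots> = lam / 12 * 2 + 1 / (t + s) * (lam / 12 * (2 * t + 1))"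
      by algebra
    finally show "- (W t powr - \<gamma>) \<le> lam / 12 * 2 + 1 / (t + s) * (lam / 12 * (2 * t + 1))"
      by (smt (verit) powr_ge_zero)
  qed (use assms W0 W3 in \<open>auto intro!: continuous_intros\<close>)
  moreover have "lam * t / 12 \<le> lam / 12 * (t\<^sup>2 + t)"
    using lam_pos by (simp add: distrib_left)
  ultimately show ?thesis by linarith
qed

text \<open>\<open>L\<close> annihilates constants while \<open>L W < 0\<close>, so on
  \<open>[a, 3]\<close> the smaller end value is a lower bound. This carries a bound at one point to
  everything on its right.\<close>

lemma min_le_solution:
  assumes "0 \<le> a" "a \<le> t" "t \<le> 3"
  shows "min (W a) lam \<le> W t"
  by (rule lower_barrier[where a = a and b = 3 and h = "\<lambda>_. min (W a) lam"
        and ?h1.0 = "\<lambda>_. 0" and ?h2.0 = "\<lambda>_. 0"]) (use assms W3 in auto)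

text \<open>A small \<open>M\<close> would make the forcing \<open>W t powr - \<gamma>\<close>
  large, at least \<open>K = M powr - \<gamma>\<close>, which pushes \<open>W\<close> up. The
  parabola takes the value \<open>K * T\<^sup>2 / 16\<close> at the midpoint, so
  \<open>T\<^sup>2 / 16 \<le> M / K = M powr (1 + \<gamma>)\<close>.\<close>

lemma maximum_lower_bound:
  assumes T: "0 < T" "T \<le> 3" and M: "\<And>t. 0 \<le> t \<Longrightarrow> t \<le> T \<Longrightarrow> W t \<le> M"
  shows "T powr \<phi> / 16 \<le> M"
proof -
  have "0 < M" using M[of T] pos[OF T] T by linarith
  define K where "K = M powr - \<gamma>"
  have K: "0 < K" using \<open>0 < M\<close> by (simp add: K_def)
  have "K * (T / 2 * (T - T / 2) / 4) \<le> W (T / 2)"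
  \<comment> \<open>Half of the admissible \<open>- K\<close> is spent on the second derivative
    \<open>- K / 2\<close>, the other half is reserved for the drift.\<close>
  proof (rule lower_barrier[where a = 0 and b = T and h = "\<lambda>t. K * (t * (T - t) / 4)"
        and ?h1.0 = "\<lambda>t. K * ((T - 2 * t) / 4)" and ?h2.0 = "\<lambda>t. K * (- 1 / 2)"])
    fix t assume t: "0 < t" "t < T"
    show "((\<lambda>t. K * (t * (T - t) / 4)) has_real_derivative K * ((T - 2 * t) / 4)) (at t)"
      by (auto intro!: derivative_eq_intros simp: field_simps)
    show "((\<lambda>t. K * ((T - 2 * t) / 4)) has_real_derivative K * (- 1 / 2)) (at t)"
      by (auto intro!: derivative_eq_intros simp: field_simps)
    have "0 \<le> 1 / 2 + 1 / (t + s) * ((T - 2 * t) / 4)"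
      using t T by (intro drift_bound(1)) auto
    then have "0 \<le> K * (1 / 2 + 1 / (t + s) * ((T - 2 * t) / 4))"
      using K by simp
    also have "\<dots> = K + (K * (- 1 / 2) + 1 / (t + s) * (K * ((T - 2 * t) / 4)))"
      by (simp add: distrib_left mult.left_commute)
    finally have "- K \<le> K * (- 1 / 2) + 1 / (t + s) * (K * ((T - 2 * t) / 4))" by linarith
    moreover have "K \<le> W t powr - \<gamma>"
      unfolding K_def using M[of t] pos[of t] t T gamma by (intro powr_mono2') auto
    ultimately show "- (W t powr - \<gamma>) \<le> K * (- 1 / 2) + 1 / (t + s) * (K * ((T - 2 * t) / 4))"
      by linarith
  qed (use T W0 pos[OF T] in \<open>auto intro!: continuous_intros\<close>)
  also have "\<dots> \<le> M" using M[of "T / 2"] T by simp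
  finally have "K * T\<^sup>2 / 16 \<le> M" by (simp add: power2_eq_square)
  then have "T\<^sup>2 / 16 \<le> M / K" using K by (simp add: field_simps)
  also have "M / K = M powr (1 + \<gamma>)"
    using \<open>0 < M\<close> by (simp add: K_def powr_minus powr_add divide_inverse)
  finally have "(T\<^sup>2 / 16) powr (1 / (1 + \<gamma>)) \<le> (M powr (1 + \<gamma>)) powr (1 / (1 + \<gamma>))"
    using gamma by (intro powr_mono2) auto
  also have "\<dots> = M" using gamma \<open>0 < M\<close> by (simp add: powr_powr)
  finally have "(T\<^sup>2 / 16) powr (1 / (1 + \<gamma>)) \<le> M" .
  moreover have "(T\<^sup>2 / 16) powr (1 / (1 + \<gamma>)) = T powr \<phi> / 16 powr (1 / (1 + \<gamma>))"
    using T by (simp add: powr_divide phi powr_powr flip: powr_numeral)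
  \<comment> \<open>A crude estimate that keeps the constant free of
    \<open>\<gamma>\<close>.\<close>
  moreover have "16 powr (1 / (1 + \<gamma>)) \<le> (16 :: real) powr 1"
    using gamma by (intro powr_mono) auto
  then have "T powr \<phi> / 16 \<le> T powr \<phi> / 16 powr (1 / (1 + \<gamma>))"
    by (intro divide_left_mono) auto
  ultimately show ?thesis by linarith
qed

text \<open>At a maximum point \<open>a\<close> of \<open>W\<close> on \<open>[0, t]\<close> the
  previous bound applies, and \<open>min_le_solution\<close> carries it from \<open>a\<close> to
  \<open>t\<close>. The cap by \<open>lam\<close> is harmless because
  \<open>t powr \<phi> \<le> 3\<close>, which explains \<open>c \<le> lam / 3\<close>.\<close>

lemma powr_lower_bound:
  assumes "0 \<le> t" "t \<le> 3" and c: "c \<le> 1 / 16" "c \<le> lam / 3"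
  shows "c * t powr \<phi> \<le> W t"
proof (cases "t = 0")
  case False
  then have t: "0 < t" using assms by simp
  have "continuous_on {0..t} W"
    using assms by (intro continuous_on_subset[OF cont]) auto
  then obtain a where a: "a \<in> {0..t}" "\<And>x. x \<in> {0..t} \<Longrightarrow> W x \<le> W a"
    using continuous_attains_sup[of "{0..t}" W] t by auto
  have "t powr \<phi> / 16 \<le> W a"
    using a by (intro maximum_lower_bound t assms) auto
  moreover have "c * t powr \<phi> \<le> 1 / 16 * t powr \<phi>"
    using c by (intro mult_right_mono) auto
  moreover have "c * t powr \<phi> \<le> lam / 3 * t powr \<phi>"
    using c by (intro mult_right_mono) auto
  moreover have "t powr \<phi> \<le> 3"
  proof -
    have "t powr \<phi> \<le> 3 powr \<phi>"
      using t assms phi_bounds by (intro powr_mono2) auto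
    also have "\<dots> \<le> 3 powr 1"
      using phi_bounds by (intro powr_mono) auto
    finally show ?thesis by simp
  qed
  then have "lam / 3 * t powr \<phi> \<le> lam / 3 * 3"
    using lam_pos by (intro mult_left_mono) auto
  ultimately have "c * t powr \<phi> \<le> min (W a) lam" by simp
  then show ?thesis using min_le_solution[of a t] a(1) assms by auto
qed (simp add: W0)

section \<open>Upper bound\<close>

text \<open>The lower bound gives \<open>W t powr - \<gamma> \<le> c powr - \<gamma> * t powr
  (\<phi> - 2)\<close>. By \<open>far_phi\<close>, \<open>L\<close> applied to
  \<open>A * t powr \<phi>\<close> is at most
  \<open>- A * \<phi> * (1 - \<phi>) / 2 * t powr (\<phi> - 2)\<close>; \<open>A\<close> is chosen
  to make these two coefficients agree in size.\<close>

lemma powr_plus_linear_upper_bound: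
  assumes "0 \<le> t" "t \<le> 3" and c: "0 < c" "c \<le> 1 / 16" "c \<le> lam / 3"
    and A: "A = 2 * c powr - \<gamma> / (\<phi> * (1 - \<phi>))"
  shows "W t \<le> A * t powr \<phi> + 4 / 3 * (lam * t)"
proof -
  have "A > 0" using A c phi_bounds by simp
  have "W t \<le> A * t powr \<phi> + lam / 3 * (t * (4 - t))"
  \<comment> \<open>The quadratic part reaches \<open>lam\<close> at 3, and its concavity beats its
    drift since \<open>\<bar>4 - 2 * t\<bar> \<le> 4\<close>. A linear function would have drift of
    the wrong sign for positive \<open>s\<close>.\<close>
  proof (rule upper_barrier[where h = "\<lambda>t. A * t powr \<phi> + lam / 3 * (t * (4 - t))"
        and ?h1.0 = "\<lambda>t. A * (\<phi> * t powr (\<phi> - 1)) + lam / 3 * (4 - 2 * t)"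
        and ?h2.0 = "\<lambda>t. A * (\<phi> * ((\<phi> - 1) * t powr (\<phi> - 2))) + lam / 3 * (- 2)"])
    show "continuous_on {0..3} (\<lambda>t. A * t powr \<phi> + lam / 3 * (t * (4 - t)))"
      using phi_bounds by (intro continuous_intros continuous_on_powr') auto
    fix t :: real assume t: "0 < t" "t < 3"
    show "((\<lambda>t. A * t powr \<phi> + lam / 3 * (t * (4 - t))) has_real_derivative
        A * (\<phi> * t powr (\<phi> - 1)) + lam / 3 * (4 - 2 * t)) (at t)"
      using t by (auto intro!: derivative_eq_intros simp: field_simps)
    show "((\<lambda>t. A * (\<phi> * t powr (\<phi> - 1)) + lam / 3 * (4 - 2 * t)) has_real_derivative
        A * (\<phi> * ((\<phi> - 1) * t powr (\<phi> - 2))) + lam / 3 * (- 2)) (at t)"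
      using t by (auto intro!: derivative_eq_intros simp: field_simps)
    have p: "t powr (\<phi> - 1) = t * t powr (\<phi> - 2)"
      using t powr_add[of t 1 "\<phi> - 2"] by simp
    have "t * (1 / (t + s)) \<le> t * \<bar>1 / (t + s)\<bar>"
      using t by (intro mult_left_mono abs_ge_self) auto
    then have "\<phi> - 1 + t * (1 / (t + s)) \<le> - ((1 - \<phi>) / 2)"
      using far_phi[OF t] by argo
    then have "(A * \<phi> * t powr (\<phi> - 2)) * (\<phi> - 1 + t * (1 / (t + s)))
        \<le> (A * \<phi> * t powr (\<phi> - 2)) * (- ((1 - \<phi>) / 2))"
      using \<open>A > 0\<close> phi_bounds by (intro mult_left_mono) auto
    also have "\<dots> = - (c powr - \<gamma> * t powr (\<phi> - 2))"
      using phi_bounds by (simp add: A field_simps)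
    also have "c powr - \<gamma> * t powr (\<phi> - 2) = (c * t powr \<phi>) powr - \<gamma>"
    proof -
      \<comment> \<open>This balance of exponents singles out \<open>\<phi>\<close>: two derivatives
        of \<open>t powr \<phi>\<close> scale like its power \<open>- \<gamma>\<close>.\<close>
      have "\<phi> - 2 = \<phi> * - \<gamma>"
        using gamma by (simp add: phi field_simps)
      then show ?thesis using c t by (simp add: powr_mult powr_powr)
    qed
    also have "- ((c * t powr \<phi>) powr - \<gamma>) \<le> - (W t powr - \<gamma>)"
      using powr_lower_bound[of t c] c t gamma by (simp add: powr_mono2')
    finally have main: "(A * \<phi> * t powr (\<phi> - 2)) * (\<phi> - 1 + t * (1 / (t + s))) \<le> - (W t powr - \<gamma>)" .
    have "- 2 + 1 / (t + s) * (4 - 2 * t) \<le> 0"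
      using t by (intro drift_bound(2)) auto
    then have "lam / 3 * (- 2 + 1 / (t + s) * (4 - 2 * t)) \<le> 0"
      using lam_pos by (simp add: mult_le_0_iff)
    moreover have "A * (\<phi> * ((\<phi> - 1) * t powr (\<phi> - 2))) + lam / 3 * (- 2)
        + 1 / (t + s) * (A * (\<phi> * t powr (\<phi> - 1)) + lam / 3 * (4 - 2 * t))
        = (A * \<phi> * t powr (\<phi> - 2)) * (\<phi> - 1 + t * (1 / (t + s)))
          + lam / 3 * (- 2 + 1 / (t + s) * (4 - 2 * t))"
      unfolding p by algebra
    ultimately show "A * (\<phi> * ((\<phi> - 1) * t powr (\<phi> - 2))) + lam / 3 * (- 2)
        + 1 / (t + s) * (A * (\<phi> * t powr (\<phi> - 1)) + lam / 3 * (4 - 2 * t)) \<le> - (W t powr - \<gamma>)"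
      using main by linarith
  qed (use assms(1,2) \<open>A > 0\<close> in auto)
  moreover have "lam / 3 * (t * (4 - t)) \<le> 4 / 3 * (lam * t)"
    using lam_pos by (simp add: algebra_simps)
  ultimately show ?thesis by linarith
qed

section \<open>Crossover and the three regimes\<close>

text \<open>Dividing by \<open>t\<close> leaves \<open>lam \<le> t powr (\<phi> - 1)\<close>, and
  \<open>\<phi> - 1\<close> is the reciprocal of the negative exponent \<open>e\<close>, so raising
  to the power \<open>e\<close> reverses the inequality.\<close>

lemma linear_le_powr_iff:
  assumes "0 < t"
  shows "lam * t \<le> t powr \<phi> \<longleftrightarrow> t \<le> lam powr ((1 + \<gamma>) / (1 - \<gamma>))"
proof -
  define e where "e = (1 + \<gamma>) / (1 - \<gamma>)"
  have e: "e < 0" "\<phi> = 1 + 1 / e"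
    using gamma by (auto simp: e_def phi field_simps)
  have inv: "(t powr (1 / e)) powr e = t"
    using e assms by (simp add: powr_powr)
  have "lam * t \<le> t powr \<phi> \<longleftrightarrow> lam \<le> t powr (1 / e)"
    using assms by (simp add: e powr_add mult.commute)
  also have "\<dots> \<longleftrightarrow> (t powr (1 / e)) powr e \<le> lam powr e"
    using lam_pos assms e powr_mono2'[of e lam "t powr (1 / e)"]
      powr_less_mono2_neg[of e "t powr (1 / e)" lam] by (auto simp: not_le intro: leI)
  finally show ?thesis unfolding inv unfolding e_def .
qed

lemma solution_comparable:
  assumes c0: "0 < c0" "c0 \<le> lam" and t: "0 \<le> t" "t \<le> 3"
    and c: "c = min (1 / 16) (c0 / 3)" and A: "A = 2 * c powr - \<gamma> / (\<phi> * (1 - \<phi>))"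
    and C: "C = A + 3 * A / c0 + 16 + 1 / c"
  shows "t \<le> lam powr ((1 + \<gamma>) / (1 - \<gamma>)) \<Longrightarrow> comparable C (W t) (t powr \<phi>)"
    and "lam powr ((1 + \<gamma>) / (1 - \<gamma>)) \<le> t \<Longrightarrow> comparable C (W t) (lam * t)"
    and "1 \<le> t \<Longrightarrow> comparable C (W t) lam"
proof -
  have cb: "0 < c" "c \<le> 1 / 16" "c \<le> lam / 3" using c0 c by auto
  have "A > 0" using A cb phi_bounds by simp
  \<comment> \<open>In order: the upper bound in the first two regimes, the upper bound for
    \<open>t \<ge> 1\<close>, the linear lower bound, and the power lower bound.\<close>
  have C_ge: "A + 4 / 3 \<le> C" "3 * A / c0 + 4 \<le> C" "12 \<le> C" "1 / c \<le> C"
    using C \<open>A > 0\<close> c0 cb by (auto simp: add_nonneg_nonneg)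
  have C_inv: "inverse C \<le> c" "inverse C \<le> 1 / 12"
    using C_ge cb le_imp_inverse_le[of "1 / c" C] le_imp_inverse_le[of 12 C] by auto
  have lower: "c * t powr \<phi> \<le> W t" "lam * t / 12 \<le> W t"
    and upper: "W t \<le> A * t powr \<phi> + 4 / 3 * (lam * t)"
    using powr_lower_bound linear_lower_bound powr_plus_linear_upper_bound t cb A by auto
  show "comparable C (W t) (t powr \<phi>)" if "t \<le> lam powr ((1 + \<gamma>) / (1 - \<gamma>))"
  proof -
    have "lam * t \<le> t powr \<phi>" using linear_le_powr_iff[of t] that t by (cases "t = 0") auto
    then have "W t \<le> (A + 4 / 3) * t powr \<phi>" using upper by (simp add: algebra_simps)
    moreover have "(A + 4 / 3) * t powr \<phi> \<le> C * t powr \<phi>"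
      using C_ge by (intro mult_right_mono) auto
    moreover have "inverse C * t powr \<phi> \<le> c * t powr \<phi>"
      using C_inv by (intro mult_right_mono) auto
    ultimately show ?thesis using lower by (simp add: comparable_def)
  qed
  have lin: "inverse C * x \<le> 1 / 12 * x" if "0 \<le> x" for x
    using C_inv that by (intro mult_right_mono) auto
  show "comparable C (W t) (lam * t)" if le: "lam powr ((1 + \<gamma>) / (1 - \<gamma>)) \<le> t"
  proof -
    have "t > 0" using le lam_pos powr_gt_zero[of lam "(1 + \<gamma>) / (1 - \<gamma>)"] by linarith
    \<comment> \<open>The equivalence settles every \<open>t\<close> strictly beyond the crossover;
      at the crossover itself both sides coincide, by the exponent identity below.\<close>
    have "t powr \<phi> \<le> lam * t"
    proof (rule ccontr)
      assume *: "\<not> t powr \<phi> \<le> lam * t"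
      then have "t = lam powr ((1 + \<gamma>) / (1 - \<gamma>))"
        using linear_le_powr_iff[OF \<open>t > 0\<close>] le by linarith
      moreover have "1 + (1 + \<gamma>) / (1 - \<gamma>) = (1 + \<gamma>) / (1 - \<gamma>) * \<phi>"
        using gamma by (simp add: phi divide_simps)
      ultimately have "lam * t = t powr \<phi>"
        using lam_pos powr_add[of lam 1 "(1 + \<gamma>) / (1 - \<gamma>)"] by (simp add: powr_powr)
      then show False using * by simp
    qed
    then have "A * t powr \<phi> \<le> A * (lam * t)" using \<open>A > 0\<close> by simp
    then have "W t \<le> (A + 4 / 3) * (lam * t)" using upper by (simp add: algebra_simps)
    moreover have "(A + 4 / 3) * (lam * t) \<le> C * (lam * t)"
      using C_ge lam_pos t by (intro mult_right_mono) auto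
    moreover have "inverse C * (lam * t) \<le> 1 / 12 * (lam * t)" using lin lam_pos t by simp
    ultimately show ?thesis using lower by (simp add: comparable_def)
  qed
  show "comparable C (W t) lam" if "1 \<le> t"
  proof -
    have "t powr \<phi> \<le> t powr 1"
      using that phi_bounds by (intro powr_mono) auto
    then have "A * t powr \<phi> \<le> A * 3"
      using \<open>A > 0\<close> t that by (intro mult_left_mono) auto
    \<comment> \<open>Here \<open>c0 \<le> lam\<close> converts a constant into a multiple of
      \<open>lam\<close>.\<close>
    also have "\<dots> \<le> A * 3 * (lam / c0)"
      using c0 \<open>A > 0\<close> by (simp add: field_simps)
    finally have "A * t powr \<phi> \<le> 3 * A / c0 * lam" by (simp add: mult_ac)
    moreover have "lam * t \<le> lam * 3"
      using t lam_pos by (intro mult_left_mono) auto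
    ultimately have "W t \<le> (3 * A / c0 + 4) * lam"
      using upper by (simp add: algebra_simps)
    moreover have "(3 * A / c0 + 4) * lam \<le> C * lam"
      using C_ge lam_pos by (intro mult_right_mono) auto
    moreover have "lam * 1 \<le> lam * t"
      using that lam_pos by (intro mult_left_mono) auto
    moreover have "inverse C * lam \<le> 1 / 12 * lam" using lin lam_pos by simp
    ultimately show ?thesis using lower unfolding comparable_def by linarith
  qed
qed

end

section \<open>Choice of constants and conclusion\<close>

text \<open>Since \<open>\<bar>t + s\<bar> \<ge> R - 3\<close>, the summand 7 yields distance at
  least 4 for \<open>far\<close>, and \<open>6 / (1 - \<phi>)\<close> yields \<open>far_phi\<close>
  from \<open>t < 3\<close>.\<close>

lemma ode_solution_imp_radial_ode:
  assumes "\<gamma> > 1" and phi: "\<phi> = 2 / (1 + \<gamma>)" and R: "R \<ge> 7 + 6 / (1 - \<phi>)"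
    and s: "s \<in> {R, - R}" and W: "ode_solution \<gamma> s lam W"
  shows "\<exists>W1 W2. radial_ode \<gamma> \<phi> s (sgn s) lam W W1 W2"
proof -
  have "\<phi> < 1" using assms by simp
  then have R7: "R \<ge> 7" using R by (smt (verit) divide_nonneg_pos)
  have dist: "\<bar>t + s\<bar> \<ge> R - 3" if "0 < t" "t < 3" for t
    using that s R7 by auto
  have "t * \<bar>1 / (t + s)\<bar> \<le> (1 - \<phi>) / 2" if t: "0 < t" "t < 3" for t
  proof -
    have "6 / (1 - \<phi>) \<le> \<bar>t + s\<bar>" using dist[OF t] R by linarith
    then have "6 \<le> (1 - \<phi>) * \<bar>t + s\<bar>" using \<open>\<phi> < 1\<close> by (simp add: field_simps)
    then have "t \<le> (1 - \<phi>) / 2 * \<bar>t + s\<bar>" using t by simp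
    then show ?thesis using dist[OF t] R7 by (simp add: pos_divide_le_eq)
  qed
  moreover have "\<bar>1 / (t + s)\<bar> \<le> 1 / 4" if t: "0 < t" "t < 3" for t
    using dist[OF t] R7 by (simp add: divide_le_eq)
  moreover have "0 < sgn s * (t + s)" if t: "0 < t" "t < 3" for t
    using s R7 t by auto
  moreover obtain W1 W2 where "\<And>t. 0 < t \<Longrightarrow> t < 3 \<Longrightarrow> (W has_real_derivative W1 t) (at t)"
    "\<And>t. 0 < t \<Longrightarrow> t < 3 \<Longrightarrow> (W1 has_real_derivative W2 t) (at t)"
    "\<And>t. 0 < t \<Longrightarrow> t < 3 \<Longrightarrow> W2 t + 1 / (t + s) * W1 t = - (W t powr - \<gamma>)"
    using W unfolding ode_solution_def by force
  moreover have "continuous_on {0..3} W" "\<And>t. 0 < t \<Longrightarrow> t \<le> 3 \<Longrightarrow> 0 < W t" "W 3 = lam" "W 0 = 0"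
    using W unfolding ode_solution_def by auto
  ultimately have "radial_ode \<gamma> \<phi> s (sgn s) lam W W1 W2"
    using assms(1,2) by unfold_locales
  then show ?thesis by blast
qed

theorem lemma3p4:
  fixes \<gamma> \<phi> c0 :: real
  assumes "\<gamma> > 1" and "\<phi> = 2 / (1 + \<gamma>)" and "c0 > 0"
  shows "\<exists>R0>3. \<forall>R\<ge>R0. \<exists>C>0. \<forall>lam\<ge>c0. \<forall>s\<in>{R, - R}. \<forall>W.
    ode_solution \<gamma> s lam W \<longrightarrow>
      (\<forall>t\<in>{0..3}.
        (t \<le> lam powr ((1 + \<gamma>) / (1 - \<gamma>)) \<longrightarrow> comparable C (W t) (t powr \<phi>)) \<and>
        (lam powr ((1 + \<gamma>) / (1 - \<gamma>)) \<le> t \<and> t \<le> 1 \<longrightarrow> comparable C (W t) (lam * t)) \<and>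
        (1 \<le> t \<and> t \<le> 3 \<longrightarrow> comparable C (W t) lam))"
proof -
  have phi: "0 < \<phi>" "\<phi> < 1" using assms by simp_all
  \<comment> \<open>All constants are built from \<open>\<gamma>\<close> and \<open>c0\<close>
    before \<open>R\<close>, \<open>lam\<close>, the sign and \<open>W\<close> are fixed, which
    gives the required uniformity.\<close>
  define c where "c = min (1 / 16) (c0 / 3)"
  define A where "A = 2 * c powr - \<gamma> / (\<phi> * (1 - \<phi>))"
  define C where "C = A + 3 * A / c0 + 16 + 1 / c"
  have "0 < c" using \<open>c0 > 0\<close> by (simp add: c_def)
  then have "0 < A" using phi by (simp add: A_def)
  then have "0 < C" using \<open>0 < c\<close> \<open>c0 > 0\<close> by (simp add: C_def add_pos_pos)
  show ?thesis
  proof (rule exI[of _ "7 + 6 / (1 - \<phi>)"], intro conjI allI impI, goal_cases)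
    case 1
    show ?case using phi by (smt (verit) divide_pos_pos)
  next
    case (2 R)
    show ?case
    proof (rule exI[of _ C], intro conjI allI impI ballI)
      show "0 < C" by fact
      fix lam s t :: real and W
      assume lam: "c0 \<le> lam" and s: "s \<in> {R, - R}" and W: "ode_solution \<gamma> s lam W" and t: "t \<in> {0..3}"
      obtain W1 W2 where "radial_ode \<gamma> \<phi> s (sgn s) lam W W1 W2"
        using ode_solution_imp_radial_ode[OF assms(1,2) 2 s W] by blast
      then interpret radial_ode \<gamma> \<phi> s "sgn s" lam W W1 W2 .
      note comparison = solution_comparable[OF \<open>c0 > 0\<close> lam _ _ c_def A_def C_def, of t]
      show "comparable C (W t) (t powr \<phi>)" if "t \<le> lam powr ((1 + \<gamma>) / (1 - \<gamma>))"
        using comparison(1) t that by simp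
      show "comparable C (W t) (lam * t)" if "lam powr ((1 + \<gamma>) / (1 - \<gamma>)) \<le> t \<and> t \<le> 1"
        using comparison(2) t that by simp
      show "comparable C (W t) lam" if "1 \<le> t \<and> t \<le> 3"
        using comparison(3) t that by simp
    qed
  qed
qed

end
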